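(* Let $\epsilon\le 1/15$ and $H\ge1$. There exists a class $\mathfrak{G}_T$ of realizable OPE problems $\mathfrak{g}=(M^{\mathfrak{g}},\pi_e^{\mathfrak{g}},\pi_b^{\mathfrak{g}},\mathcal{F}^{\mathfrak{g}})$, in which the learner has access to offline trajectories of $M^{\mathfrak{g}}$ sampled using $\pi_b^{\mathfrak{g}}$, such that for every $\mathfrak{g}\in\mathfrak{G}_T$ the concentrability coefficient of $\pi_e^{\mathfrak{g}}$ with respect to $(d_h^{\pi_b^{\mathfrak{g}}}(\cdot;M^{\mathfrak{g}}))_h$ is $O(H^3)$ and $|\mathcal{F}^{\mathfrak{g}}|=2$. Furthermore, any offline policy evaluation algorithm that, for every $\mathfrak{g}\in\mathfrak{G}_T$, estimates $V^{\pi_e^{\mathfrak{g}}}(\rho^{\mathfrak{g}};M^{\mathfrak{g}})$ up to precision $\epsilon/(16H)$ in expectation must use $2^{\Omega(H)}$ offline trajectories in some $\mathfrak{g}\in\mathfrak{G}_T$.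
   Context: Layered finite-horizon MDPs $M=(\mathcal{X},\mathcal{A},T,r,H,\rho)$ with rewards in $[-1,1]$; occupancy $d_h^\pi(x,a;M)=\Pr(x_h=x)\pi(a|x)$; $Q^\pi$, $V^\pi(\rho)$. A trajectory sample is $(x_1,a_1,r_1,x_2,\dots,x_H)$ generated in $M$ with $x_1\sim\rho$, $a_h\sim\pi_b(\cdot|x_h)$, $r_h\sim r(x_h,a_h)$, $x_{h+1}\sim T(\cdot|x_h,a_h)$. An OPE problem $(M,\pi_e,\pi_b,\mathcal{F})$ with $\mathcal{F}$ a class of functions $\mathcal{X}\times\mathcal{A}\to[-1,1]$ is realizable if $Q^{\pi_e}(\cdot;M)\in\mathcal{F}$. Concentrability coefficient: $\max_h\max_{x,a}d_h^{\pi_e}(x,a)/d_h^{\pi_b}(x,a)$. "$2^{\Omega(H)}$" means at least $2^{cH}$ for an absolute constant $c>0$. *)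

theory Defs
  imports "HOL-Probability.Probability"
begin

record mdp =
  states :: "nat set"
  acts   :: "nat set"
  layer  :: "nat \<Rightarrow> nat"
  trans  :: "nat \<Rightarrow> nat \<Rightarrow> nat pmf"
  rew    :: "nat \<Rightarrow> nat \<Rightarrow> real pmf"
  hor    :: nat
  init   :: "nat pmf"

type_synonym policy = "nat \<Rightarrow> nat pmf"
type_synonym fclass = "(nat \<Rightarrow> nat \<Rightarrow> real) set"
type_synonym trajectory = "(nat \<times> nat \<times> real) list"

definition layered_mdp :: "mdp \<Rightarrow> bool" where
  "layered_mdp M \<longleftrightarrow>
     finite (states M) \<and> finite (acts M) \<and> acts M \<noteq> {} \<and> hor M \<ge> 1 \<and>
     (\<forall>x\<in>states M. layer M x \<in> {1..hor M}) \<and>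
     set_pmf (init M) \<subseteq> {x\<in>states M. layer M x = 1} \<and>
     (\<forall>x\<in>states M. \<forall>a\<in>acts M. layer M x < hor M \<longrightarrow>
        set_pmf (trans M x a) \<subseteq> {y\<in>states M. layer M y = layer M x + 1}) \<and>
     (\<forall>x\<in>states M. \<forall>a\<in>acts M. set_pmf (rew M x a) \<subseteq> {-1..1})"

definition valid_policy :: "mdp \<Rightarrow> policy \<Rightarrow> bool" where
  "valid_policy M \<pi> \<longleftrightarrow> (\<forall>x\<in>states M. set_pmf (\<pi> x) \<subseteq> acts M)"

primrec vfun :: "mdp \<Rightarrow> policy \<Rightarrow> nat \<Rightarrow> nat \<Rightarrow> real" where
  "vfun M \<pi> 0 = (\<lambda>x. 0)"
| "vfun M \<pi> (Suc k) = (\<lambda>x. measure_pmf.expectation (\<pi> x)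
      (\<lambda>a. measure_pmf.expectation (rew M x a) (\<lambda>r. r)
         + measure_pmf.expectation (trans M x a) (vfun M \<pi> k)))"

text \<open>Q^\<pi>(x,a;M) for a layered MDP: state x lies in layer h = layer x, and
  H - h steps remain after taking a at x.\<close>
definition Qpi :: "mdp \<Rightarrow> policy \<Rightarrow> nat \<Rightarrow> nat \<Rightarrow> real" where
  "Qpi M \<pi> x a = measure_pmf.expectation (rew M x a) (\<lambda>r. r)
      + measure_pmf.expectation (trans M x a) (vfun M \<pi> (hor M - layer M x))"

definition Vpi :: "mdp \<Rightarrow> policy \<Rightarrow> real" where
  "Vpi M \<pi> = measure_pmf.expectation (init M) (vfun M \<pi> (hor M))"

text \<open>Distribution of x_{k+1}.\<close>
primrec state_dist :: "mdp \<Rightarrow> policy \<Rightarrow> nat \<Rightarrow> nat pmf" where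
  "state_dist M \<pi> 0 = init M"
| "state_dist M \<pi> (Suc k) = bind_pmf (state_dist M \<pi> k) (\<lambda>x. bind_pmf (\<pi> x) (\<lambda>a. trans M x a))"

text \<open>Occupancy d_h^\<pi>(x,a;M) = Pr(x_h = x) \<pi>(a|x), for h \<ge> 1.\<close>
definition occ :: "mdp \<Rightarrow> policy \<Rightarrow> nat \<Rightarrow> nat \<Rightarrow> nat \<Rightarrow> real" where
  "occ M \<pi> h x a = pmf (state_dist M \<pi> (h - 1)) x * pmf (\<pi> x) a"

definition concentrability :: "mdp \<Rightarrow> policy \<Rightarrow> policy \<Rightarrow> ereal" where
  "concentrability M \<pi>e \<pi>b =
     (SUP h\<in>{1..hor M}. SUP x\<in>states M. SUP a\<in>acts M.
        (if occ M \<pi>b h x a = 0 then (if occ M \<pi>e h x a = 0 then 0 else \<infinity>)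
         else ereal (occ M \<pi>e h x a / occ M \<pi>b h x a)))"

primrec gen_traj :: "mdp \<Rightarrow> policy \<Rightarrow> nat \<Rightarrow> nat \<Rightarrow> trajectory pmf" where
  "gen_traj M \<pi> 0 = (\<lambda>x. return_pmf [])"
| "gen_traj M \<pi> (Suc k) = (\<lambda>x. bind_pmf (\<pi> x) (\<lambda>a. bind_pmf (rew M x a) (\<lambda>r.
      bind_pmf (trans M x a) (\<lambda>y. map_pmf (\<lambda>t. (x, a, r) # t) (gen_traj M \<pi> k y)))))"

definition traj_dist :: "mdp \<Rightarrow> policy \<Rightarrow> trajectory pmf" where
  "traj_dist M \<pi> = bind_pmf (init M) (gen_traj M \<pi> (hor M))"

primrec iid_pmf :: "nat \<Rightarrow> 'a pmf \<Rightarrow> 'a list pmf" where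
  "iid_pmf 0 p = return_pmf []"
| "iid_pmf (Suc n) p = bind_pmf p (\<lambda>x. map_pmf (\<lambda>xs. x # xs) (iid_pmf n p))"

type_synonym ope_problem = "mdp \<times> policy \<times> policy \<times> fclass"

text \<open>Functions of F are functions X \<times> A \<rightarrow> [-1,1], represented canonically
  (value 0 outside X \<times> A).\<close>
definition ope_problem_wf :: "nat \<Rightarrow> ope_problem \<Rightarrow> bool" where
  "ope_problem_wf H g = (case g of (M, \<pi>e, \<pi>b, F) \<Rightarrow>
     layered_mdp M \<and> hor M = H \<and> valid_policy M \<pi>e \<and> valid_policy M \<pi>b \<and>
     (\<forall>f\<in>F. \<forall>x a. f x a \<in> {-1..1} \<and>
        ((x \<notin> states M \<or> a \<notin> acts M) \<longrightarrow> f x a = 0)))"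

definition realizable :: "ope_problem \<Rightarrow> bool" where
  "realizable g = (case g of (M, \<pi>e, \<pi>b, F) \<Rightarrow>
     (\<lambda>x a. if x \<in> states M \<and> a \<in> acts M then Qpi M \<pi>e x a else 0) \<in> F)"

text \<open>An (possibly randomized) OPE algorithm receives the target policy, the function
  class and a dataset of trajectories, and outputs a distribution over estimates.
  Its expected error with n trajectories on problem g:\<close>
definition ope_error ::
  "(policy \<Rightarrow> fclass \<Rightarrow> trajectory list \<Rightarrow> real pmf) \<Rightarrow> nat \<Rightarrow> ope_problem \<Rightarrow> ennreal" where
  "ope_error alg n g = (case g of (M, \<pi>e, \<pi>b, F) \<Rightarrow>
     (\<integral>\<^sup>+ v. ennreal \<bar>v - Vpi M \<pi>e\<bar>
        \<partial>measure_pmf (bind_pmf (iid_pmf n (traj_dist M \<pi>b)) (alg \<pi>e F))))"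

end

theory Submission
  imports Defs
begin

text \<open>
  A hidden set \<open>S\<close> labels an identity \<open>(i, b)\<close>, \<open>i < N\<close>, as good if \<open>b = (i \<in> S)\<close> and as bad
  otherwise. Episodes start at a uniformly random good identity; action 1 keeps the identity and
  action 0 replaces it by a uniformly random one. In the last layer a good identity ends in a
  state of value \<open>\<plusminus>1\<close> with mean \<open>s/4\<close>, \<open>s = \<plusminus>1\<close>, whereas a bad one ends with probability \<open>1/2\<close>
  in a trap of value \<open>s\<close> and otherwise in a state of value \<open>\<plusminus>1\<close> with mean \<open>-s/2\<close>. Hence good and
  bad identities have the same value \<open>s/4\<close>, and the Q-function depends on \<open>s\<close> but not on \<open>S\<close>.

  The target policy (always 1) only ever visits good identities and never the trap, while the
  behaviour policy (uniform, except that it plays 0 in the trap and so never sees its value)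
  visits every good identity at least half as often as the target policy; this bounds the
  concentrability by 4.

  The even mixture of the good and the bad exit law does not depend on \<open>s\<close>. A trajectory of the
  behaviour policy is therefore informative only if it never plays 0, which has probability
  \<open>2 ^ -(H - 1)\<close>, or if an identity is seen repeatedly, which is unlikely for large \<open>N\<close>. Averaging
  over a uniformly random \<open>S\<close> makes this precise: a functional that is insensitive to flipping the
  label of one identity has almost the same mean for both values of \<open>s\<close>, first for one
  trajectory and then, replacing trajectories one by one, for a whole data set.
\<close>

section \<open>Expectations of bounded functions\<close>

abbreviation Ex :: "'a pmf \<Rightarrow> ('a \<Rightarrow> real) \<Rightarrow> real" where
  "Ex \<equiv> measure_pmf.expectation"

lemma integrable_pmf_bounded:
  fixes f :: "'a \<Rightarrow> real"
  assumes "\<And>x. \<bar>f x\<bar> \<le> B"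
  shows "integrable (measure_pmf p) f"
  using assms by (intro measure_pmf.integrable_const_bound[where B = B]) auto

lemma expectation_bind_pmf:
  assumes "\<And>x. \<bar>f x\<bar> \<le> B"
  shows "Ex (bind_pmf p k) f = Ex p (\<lambda>x. Ex (k x) f)"
  unfolding measure_pmf_bind
  by (rule integral_bind[where K = "count_space UNIV" and B = B and B' = 1])
     (use assms measurable_measure_pmf[of k] in \<open>auto simp: measure_pmf.emeasure_le_1\<close>)

lemma expectation_abs_le:
  assumes "\<And>x. x \<in> set_pmf p \<Longrightarrow> \<bar>f x\<bar> \<le> B"
  shows "\<bar>Ex p f\<bar> \<le> B"
proof -
  have int: "integrable (measure_pmf p) f"
    using assms by (intro measure_pmf.integrable_const_bound[where B = B]) (auto simp: AE_measure_pmf_iff)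
  have "\<bar>Ex p f\<bar> \<le> Ex p (\<lambda>x. \<bar>f x\<bar>)"
    by (rule integral_abs_bound)
  also have "\<dots> \<le> B"
    using int assms by (intro measure_pmf.integral_le_const) (auto simp: AE_measure_pmf_iff)
  finally show ?thesis .
qed

lemma expectation_abs_le_expectation:
  assumes "\<And>x. x \<in> set_pmf p \<Longrightarrow> \<bar>f x\<bar> \<le> g x" and "\<And>x. \<bar>g x\<bar> \<le> B"
  shows "\<bar>Ex p f\<bar> \<le> Ex p g"
proof -
  have le: "\<bar>f x\<bar> \<le> B" if "x \<in> set_pmf p" for x
    using assms(1)[OF that] assms(2)[of x] by linarith
  have int: "integrable (measure_pmf p) f"
    using le by (intro measure_pmf.integrable_const_bound[where B = B]) (auto simp: AE_measure_pmf_iff)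
  have "\<bar>Ex p f\<bar> \<le> Ex p (\<lambda>x. \<bar>f x\<bar>)"
    by (rule integral_abs_bound)
  also have "\<dots> \<le> Ex p g"
    using int assms(1)
    by (intro integral_mono_AE integrable_abs integrable_pmf_bounded[OF assms(2)])
       (auto simp: AE_measure_pmf_iff)
  finally show ?thesis .
qed

lemma expectation_unit:
  assumes "\<And>x. f x \<in> {0..1}"
  shows "Ex p f \<in> {0..1}"
proof -
  have "integrable (measure_pmf p) f"
    using assms by (intro integrable_pmf_bounded[where B = 1]) (simp add: abs_le_iff order_trans[of "-1" 0])
  then show ?thesis
    using assms by (auto intro!: measure_pmf.integral_le_const measure_pmf.integral_ge_const)
qed

text \<open>Fubini for bounded functions, obtained from the fact that two independent draws
  commute.\<close>

lemma expectation_swap: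
  assumes "\<And>x y. \<bar>f x y\<bar> \<le> B"
  shows "Ex p (\<lambda>x. Ex q (\<lambda>y. f x y)) = Ex q (\<lambda>y. Ex p (\<lambda>x. f x y))"
proof -
  have *: "bind_pmf p (\<lambda>x. map_pmf (\<lambda>y. f x y) q) = bind_pmf q (\<lambda>y. map_pmf (\<lambda>x. f x y) p)"
    unfolding map_pmf_def by (rule bind_commute_pmf)
  \<comment> \<open>The identity on the reals is unbounded, so a truncation that fixes every value
    of \<open>f\<close> is integrated instead.\<close>
  let ?g = "\<lambda>z. max (- \<bar>B\<bar>) (min \<bar>B\<bar> z)"
  have g: "?g (f x y) = f x y" for x y
    using assms[of x y] by auto
  have "Ex (bind_pmf p (\<lambda>x. map_pmf (\<lambda>y. f x y) q)) ?g = Ex (bind_pmf q (\<lambda>y. map_pmf (\<lambda>x. f x y) p)) ?g"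
    by (simp only: *)
  then show ?thesis
    by (simp add: expectation_bind_pmf[where B = "\<bar>B\<bar>"] g abs_le_iff)
qed

text \<open>One coin toss of the behaviour policy in a comparison of two processes:
  \<open>a1\<close>, \<open>a2\<close> stand for the branches that keep the identity,
  \<open>f1\<close>, \<open>f2\<close> for those that redraw it.\<close>

lemma expectation_diff_half_sum:
  assumes "\<And>w. \<bar>a1 w\<bar> \<le> 1" "\<And>w. \<bar>a2 w\<bar> \<le> 1" "\<And>w. \<bar>f1 w\<bar> \<le> 1" "\<And>w. \<bar>f2 w\<bar> \<le> 1"
  shows "Ex W (\<lambda>w. (a1 w + f1 w) / 2 - (a2 w + f2 w) / 2)
      = (Ex W (\<lambda>w. a1 w - a2 w) + Ex W (\<lambda>w. f1 w - f2 w)) / 2"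
proof -
  have int: "integrable W a1" "integrable W a2" "integrable W f1" "integrable W f2"
    by (fact integrable_pmf_bounded[OF assms(1)] integrable_pmf_bounded[OF assms(2)]
        integrable_pmf_bounded[OF assms(3)] integrable_pmf_bounded[OF assms(4)])+
  have "Ex W (\<lambda>w. (a1 w + f1 w) / 2 - (a2 w + f2 w) / 2)
      = Ex W (\<lambda>w. ((a1 w - a2 w) + (f1 w - f2 w)) / 2)"
    by (intro Bochner_Integration.integral_cong refl) (simp add: field_simps)
  with int show ?thesis by simp
qed

lemma abs_half_sum_le:
  fixes x y :: real
  assumes "\<bar>x\<bar> \<le> a" "\<bar>y\<bar> \<le> b"
  shows "\<bar>(x + y) / 2\<bar> \<le> (a + b) / 2"
  using assms abs_triangle_ineq[of x y] by simp

section \<open>Observations, exit laws and label flips\<close>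

datatype obs = Node nat nat bool | Final bool | Trap

instance obs :: countable
  by countable_datatype

definition signum :: "bool \<Rightarrow> real" where
  "signum c = (if c then 1 else -1)"

fun Qval :: "bool \<Rightarrow> obs \<Rightarrow> nat \<Rightarrow> real" where
  "Qval s (Node h i b) a = signum s / 4"
| "Qval s (Final c) a = signum c"
| "Qval s Trap a = (if a = 1 then signum s else 0)"

fun reward :: "bool \<Rightarrow> obs \<Rightarrow> nat \<Rightarrow> real" where
  "reward s (Node h i b) a = 0"
| "reward s (Final c) a = signum c"
| "reward s Trap a = (if a = 1 then signum s else 0)"

text \<open>Eight equally likely outcomes. In units of \<open>signum s\<close> a good exit has value
  (5 - 3)/8 and a bad one (4 + 1 - 3)/8, both 1/4. The even mixture gives \<open>Trap\<close> mass
  1/4 and each final state mass 3/8, whatever \<open>s\<close> is.\<close>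

definition exit_pmf :: "bool \<Rightarrow> bool \<Rightarrow> obs pmf" where
  "exit_pmf s good = map_pmf (\<lambda>k. if k < 4 \<and> \<not> good then Trap else Final (if k < 5 then s else \<not> s))
     (pmf_of_set {..<8::nat})"

lemma lessThan_8: "{..<8::nat} = {0,1,2,3,4,5,6,7}"
  by auto

lemma expectation_exit_pmf:
  "Ex (exit_pmf s good) g =
     ((if good then 5 * g (Final s) else 4 * g Trap + g (Final s)) + 3 * g (Final (\<not> s))) / 8"
proof -
  have "{..<8::nat} \<noteq> {}" by (auto simp: lessThan_empty_iff)
  then show ?thesis
    unfolding exit_pmf_def by (simp add: integral_pmf_of_set) (simp add: lessThan_8)
qed

lemma set_exit_pmf: "set_pmf (exit_pmf s good) \<subseteq> insert Trap (range Final)"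
  by (auto simp: exit_pmf_def)

lemma Trap_notin_exit_pmf_good: "Trap \<notin> set_pmf (exit_pmf s True)"
  by (auto simp: exit_pmf_def)

definition flip :: "nat \<Rightarrow> nat set \<Rightarrow> nat set" where
  "flip i S = (if i \<in> S then S - {i} else insert i S)"

lemma mem_flip: "j \<in> flip i S \<longleftrightarrow> (if j = i then i \<notin> S else j \<in> S)"
  by (auto simp: flip_def)

lemma flip_flip: "flip i (flip i S) = S"
  by (auto simp: flip_def)

lemma map_flip_uniform:
  assumes "i < N"
  shows "map_pmf (flip i) (pmf_of_set (Pow {..<N})) = pmf_of_set (Pow {..<N})"
proof (rule map_pmf_of_set_bij_betw)
  show "bij_betw (flip i) (Pow {..<N}) (Pow {..<N})"
    by (rule bij_betw_byWitness[where f' = "flip i"]) (use assms in \<open>auto simp: flip_flip\<close>, (auto simp: flip_def split: if_splits))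
qed auto

section \<open>A family of decision processes with hidden labels\<close>

declare One_nat_def [simp del]

locale hidden_label_mdp =
  fixes H N :: nat
  assumes H_pos: "1 \<le> H" and N_pos: "1 \<le> N"
begin

text \<open>For each index exactly one bit is good, so a fresh identity is good with probability 1/2
  although its law does not involve \<open>S\<close>.\<close>

definition fresh :: "(nat \<times> bool) pmf" where
  "fresh = pmf_of_set ({..<N} \<times> UNIV)"

definition labelled :: "nat set \<Rightarrow> (nat \<times> bool) pmf" where
  "labelled S = map_pmf (\<lambda>i. (i, i \<in> S)) (pmf_of_set {..<N})"

text \<open>Layer \<open>H\<close> is entered through the exit law; this is the only place where
  transitions consult \<open>s\<close> or \<open>S\<close>.\<close>

definition arrive :: "bool \<Rightarrow> nat set \<Rightarrow> nat \<Rightarrow> nat \<times> bool \<Rightarrow> obs pmf" where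
  "arrive s S h = (\<lambda>(i, b). if h < H then return_pmf (Node h i b) else exit_pmf s (b = (i \<in> S)))"

text \<open>Successors of last-layer states lie beyond the horizon; \<open>Trap\<close> is a default
  value for them.\<close>

fun step :: "bool \<Rightarrow> nat set \<Rightarrow> obs \<Rightarrow> nat \<Rightarrow> obs pmf" where
  "step s S (Node h i b) a =
     (if a = 1 then arrive s S (Suc h) (i, b) else bind_pmf fresh (arrive s S (Suc h)))"
| "step s S _ a = return_pmf Trap"

fun level :: "obs \<Rightarrow> nat" where
  "level (Node h i b) = h"
| "level _ = H"

definition obs_set :: "obs set" where
  "obs_set = (\<lambda>(h, i, b). Node h i b) ` ({1..<H} \<times> {..<N} \<times> UNIV) \<union> insert Trap (range Final)"

lemma mem_obs_set [simp]:
  "Node h i b \<in> obs_set \<longleftrightarrow> 1 \<le> h \<and> h < H \<and> i < N" "Final c \<in> obs_set" "Trap \<in> obs_set"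
  by (auto simp: obs_set_def image_iff)

definition model :: "bool \<Rightarrow> nat set \<Rightarrow> mdp" where
  "model s S = \<lparr>states = to_nat ` obs_set, acts = {0, 1},
     layer = (\<lambda>x. level (from_nat x)),
     trans = (\<lambda>x a. map_pmf to_nat (step s S (from_nat x) a)),
     rew = (\<lambda>x a. return_pmf (reward s (from_nat x) a)),
     hor = H,
     init = map_pmf to_nat (bind_pmf (labelled S) (arrive s S 1))\<rparr>"

lemma model_simps [simp]:
  "states (model s S) = to_nat ` obs_set" "acts (model s S) = {0, 1}"
  "layer (model s S) x = level (from_nat x)"
  "trans (model s S) x a = map_pmf to_nat (step s S (from_nat x) a)"
  "rew (model s S) x a = return_pmf (reward s (from_nat x) a)"
  "hor (model s S) = H"
  "init (model s S) = map_pmf to_nat (bind_pmf (labelled S) (arrive s S 1))"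
  by (simp_all add: model_def)

definition target :: policy where
  "target = (\<lambda>x. return_pmf 1)"

definition behaviour :: policy where
  "behaviour = (\<lambda>x. case from_nat x of
     Node h i b \<Rightarrow> pmf_of_set {0, 1} | Final c \<Rightarrow> return_pmf 1 | Trap \<Rightarrow> return_pmf 0)"

definition Qfun :: "bool \<Rightarrow> nat \<Rightarrow> nat \<Rightarrow> real" where
  "Qfun s x a = (if x \<in> to_nat ` obs_set \<and> a \<in> {0, 1} then Qval s (from_nat x) a else 0)"

text \<open>Both policies and the function class are the same for all \<open>s\<close> and
  \<open>S\<close>, so an algorithm can learn the sign only from the data.\<close>

definition problem :: "bool \<Rightarrow> nat set \<Rightarrow> ope_problem" where
  "problem s S = (model s S, target, behaviour, range Qfun)"

lemma set_fresh: "set_pmf fresh = {..<N} \<times> UNIV"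
  unfolding fresh_def using N_pos by (subst set_pmf_of_set) (auto simp: lessThan_empty_iff)

lemma set_labelled: "set_pmf (labelled S) \<subseteq> {..<N} \<times> UNIV"
  unfolding labelled_def using N_pos by (simp, subst set_pmf_of_set) (auto simp: lessThan_empty_iff)

lemma set_arrive:
  assumes "p \<in> {..<N} \<times> UNIV" "1 \<le> h" "h \<le> H"
  shows "set_pmf (arrive s S h p) \<subseteq> {x \<in> obs_set. level x = h}"
proof (cases "h < H")
  case True
  with assms show ?thesis
    by (cases p) (auto simp: arrive_def)
next
  case False
  obtain i b where "p = (i, b)" by (cases p)
  moreover have "x \<in> obs_set \<and> level x = H" if "x \<in> insert Trap (range Final)" for x
    using that by (auto simp: obs_set_def)
  ultimately show ?thesis
    using assms False set_exit_pmf[of s "b = (i \<in> S)"] by (auto simp: arrive_def)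
qed

lemma set_bind_arrive:
  assumes "set_pmf p \<subseteq> {..<N} \<times> UNIV" "1 \<le> h" "h \<le> H"
  shows "set_pmf (bind_pmf p (arrive s S h)) \<subseteq> {x \<in> obs_set. level x = h}"
  unfolding set_bind_pmf using assms by (intro UN_least set_arrive) auto

lemma set_step:
  assumes "x \<in> obs_set" "level x < H"
  shows "set_pmf (step s S x a) \<subseteq> {y \<in> obs_set. level y = Suc (level x)}"
proof -
  from assms obtain h i b where x: "x = Node h i b" "h < H" "i < N"
    by (cases x) (auto simp: obs_set_def)
  show ?thesis
    using set_arrive[of "(i, b)" "Suc h" s S] set_bind_arrive[of fresh "Suc h" s S] set_fresh x
    by simp
qed

lemma layered_mdp_model: "layered_mdp (model s S)"
  unfolding layered_mdp_def
proof (intro conjI ballI impI)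
  show "finite (states (model s S))"
    by (simp add: obs_set_def)
  show "set_pmf (init (model s S)) \<subseteq> {x \<in> states (model s S). layer (model s S) x = 1}"
    using set_bind_arrive[OF set_labelled[of S] order_refl H_pos, of s S] by auto
next
  fix x a assume x: "x \<in> states (model s S)" and l: "layer (model s S) x < hor (model s S)"
  from x obtain y where y: "y \<in> obs_set" "x = to_nat y"
    by auto
  have "set_pmf (step s S y a) \<subseteq> {z \<in> obs_set. level z = Suc (level y)}"
    using l by (intro set_step y) (simp add: y)
  then show "set_pmf (trans (model s S) x a) \<subseteq>
      {z \<in> states (model s S). layer (model s S) z = layer (model s S) x + 1}"
    by (auto simp: y)
next
  fix x a
  show "set_pmf (rew (model s S) x a) \<subseteq> {- 1..1}"
    by (cases "(s, from_nat x :: obs, a)" rule: reward.cases) (auto simp: signum_def)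
qed (use H_pos in \<open>auto simp: obs_set_def\<close>)

section \<open>Values, realizability and the function class\<close>

lemma expectation_Qval_arrive:
  "Ex (arrive s S h p) (\<lambda>y. Qval s y 1) = signum s / 4"
  by (auto simp: arrive_def expectation_exit_pmf signum_def split: prod.splits)

lemma abs_Qval_le: "\<bar>Qval s y a\<bar> \<le> 1"
  by (cases y) (auto simp: signum_def)

lemma expectation_Qval_bind_arrive:
  "Ex (bind_pmf p (arrive s S h)) (\<lambda>y. Qval s y 1) = signum s / 4"
  by (simp add: expectation_Qval_arrive expectation_bind_pmf[where B = 1] abs_Qval_le)

lemma expectation_Qval_step:
  assumes "level x < H"
  shows "Ex (step s S x a) (\<lambda>y. Qval s y 1) = signum s / 4"
  using assms by (cases x) (simp_all add: expectation_Qval_arrive expectation_Qval_bind_arrive)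

lemma reward_node: "level x < H \<Longrightarrow> reward s x a = 0 \<and> Qval s x a = signum s / 4"
  by (cases x) auto

lemma reward_final: "x \<in> obs_set \<Longrightarrow> level x = H \<Longrightarrow> reward s x a = Qval s x a"
  by (cases x) (auto simp: obs_set_def)

text \<open>Backward induction: with \<open>k\<close> steps left the process is in layer
  \<open>H + 1 - k\<close>, so \<open>k = 0\<close> is vacuous, \<open>k = 1\<close> is the last
  layer, and below it the value \<open>signum s / 4\<close> is preserved by every
  transition.\<close>

lemma vfun_model:
  assumes "x \<in> obs_set" "level x + k = Suc H"
  shows "vfun (model s S) target k (to_nat x) = Qval s x 1"
  using assms
proof (induction k arbitrary: x)
  case 0
  then have "level x \<le> H" by (cases x) (auto simp: obs_set_def)
  with 0 show ?case by simp
next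
  case (Suc k)
  show ?case
  proof (cases "level x = H")
    case True
    with Suc.prems have "k = 0" by simp
    then show ?thesis
      using reward_final[OF Suc.prems(1) True] by (simp add: target_def)
  next
    case False
    with Suc.prems have l: "level x < H"
      by (cases x) (auto simp: obs_set_def)
    have "Ex (step s S x 1) (\<lambda>y. vfun (model s S) target k (to_nat y)) = Ex (step s S x 1) (\<lambda>y. Qval s y 1)"
      using set_step[OF Suc.prems(1) l, of s S 1] Suc
      by (intro integral_cong_AE) (auto simp: AE_measure_pmf_iff)
    then show ?thesis
      using expectation_Qval_step[OF l, of s S 1] reward_node[OF l, of s 1]
      by (simp add: target_def)
  qed
qed

lemma Qpi_model:
  assumes x: "x \<in> obs_set"
  shows "Qpi (model s S) target (to_nat x) a = Qval s x a"
proof (cases "level x = H")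
  case True
  then show ?thesis
    using reward_final[OF x True] by (simp add: Qpi_def)
next
  case False
  with x have l: "level x < H"
    by (cases x) (auto simp: obs_set_def)
  have "Ex (step s S x a) (\<lambda>y. vfun (model s S) target (H - level x) (to_nat y))
      = Ex (step s S x a) (\<lambda>y. Qval s y 1)"
    using set_step[OF x l, of s S a] l vfun_model
    by (intro integral_cong_AE) (auto simp: AE_measure_pmf_iff)
  then show ?thesis
    using expectation_Qval_step[OF l, of s S a] reward_node[OF l, of s a]
    by (simp add: Qpi_def)
qed

lemma Vpi_model: "Vpi (model s S) target = signum s / 4"
proof -
  let ?D = "bind_pmf (labelled S) (arrive s S 1)"
  have "set_pmf ?D \<subseteq> {x \<in> obs_set. level x = 1}"
    by (rule set_bind_arrive[OF set_labelled order_refl H_pos])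
  then have "Ex ?D (\<lambda>y. vfun (model s S) target H (to_nat y)) = Ex ?D (\<lambda>y. Qval s y 1)"
    using vfun_model by (intro integral_cong_AE) (auto simp: AE_measure_pmf_iff)
  then show ?thesis
    by (simp add: Vpi_def expectation_Qval_bind_arrive)
qed

lemma ope_problem_wf_problem: "ope_problem_wf H (problem s S)"
proof -
  have "\<bar>Qfun t x a\<bar> \<le> 1" for t x a
    by (simp add: Qfun_def abs_Qval_le)
  moreover have "set_pmf (behaviour x) \<subseteq> {0, 1}" for x
    by (auto simp: behaviour_def split: obs.splits)
  moreover have "Qfun t x a = 0" if "x \<notin> to_nat ` obs_set \<or> a \<notin> {0, 1}" for t x a
    using that by (auto simp: Qfun_def)
  ultimately show ?thesis
    using layered_mdp_model[of s S]
    by (simp add: ope_problem_wf_def problem_def valid_policy_def target_def abs_le_iff minus_le_iff)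
qed

lemma realizable_problem: "realizable (problem s S)"
proof -
  have "(\<lambda>x a. if x \<in> states (model s S) \<and> a \<in> acts (model s S) then Qpi (model s S) target x a else 0) = Qfun s"
    by (intro ext) (auto simp: Qfun_def Qpi_model)
  then show ?thesis
    by (simp add: realizable_def problem_def)
qed

lemma card_range_Qfun: "card (range Qfun) = 2"
proof -
  have "Qfun True (to_nat Trap) 1 \<noteq> Qfun False (to_nat Trap) 1"
    by (simp add: Qfun_def obs_set_def signum_def)
  then have "Qfun True \<noteq> Qfun False" by metis
  then show ?thesis by (simp add: UNIV_bool)
qed

end

section \<open>Occupancies and concentrability\<close>

text \<open>Domination of one law by another passes through a common kernel; this carries a bound on
  identities over to observations.\<close>

lemma pmf_bind_mono:
  assumes "\<And>p. pmf P p \<le> c * pmf Q p" "0 \<le> c"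
  shows "pmf (bind_pmf P f) x \<le> c * pmf (bind_pmf Q f) x"
proof -
  have "ennreal (pmf (bind_pmf P f) x) = (\<integral>\<^sup>+p. ennreal (pmf P p) * ennreal (pmf (f p) x) \<partial>count_space UNIV)"
    by (simp add: ennreal_pmf_bind nn_integral_measure_pmf)
  also have "\<dots> \<le> (\<integral>\<^sup>+p. ennreal c * (ennreal (pmf Q p) * ennreal (pmf (f p) x)) \<partial>count_space UNIV)"
    using assms by (intro nn_integral_mono) (simp add: mult.assoc[symmetric] ennreal_mult[symmetric] mult_right_mono)
  also have "\<dots> = ennreal c * ennreal (pmf (bind_pmf Q f) x)"
    by (simp add: nn_integral_cmult ennreal_pmf_bind nn_integral_measure_pmf)
  also have "\<dots> = ennreal (c * pmf (bind_pmf Q f) x)"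
    using assms by (simp add: ennreal_mult)
  finally show ?thesis
    using assms by simp
qed

abbreviation coin :: "nat pmf" where
  "coin \<equiv> pmf_of_set {0, 1}"

lemma expectation_coin: "Ex coin f = (f 0 + f 1) / 2"
  by (simp add: integral_pmf_of_set)

context hidden_label_mdp
begin

lemma behaviour_simps [simp]:
  "behaviour (to_nat (Node h i b)) = coin"
  "behaviour (to_nat (Final c)) = return_pmf 1"
  "behaviour (to_nat Trap) = return_pmf 0"
  by (simp_all add: behaviour_def)

lemma arrive_node: "h < H \<Longrightarrow> arrive s S h (i, b) = return_pmf (Node h i b)"
  by (simp add: arrive_def)

lemma arrive_last: "arrive s S H (i, b) = exit_pmf s (b = (i \<in> S))"
  by (simp add: arrive_def)

lemma state_dist_target:
  "k < H \<Longrightarrow> state_dist (model s S) target k = map_pmf to_nat (bind_pmf (labelled S) (arrive s S (Suc k)))"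
proof (induction k)
  case 0
  then show ?case by (simp add: One_nat_def)
next
  case (Suc k)
  have "bind_pmf (arrive s S (Suc k) p) (\<lambda>x. map_pmf to_nat (step s S x 1)) =
      map_pmf to_nat (arrive s S (Suc (Suc k)) p)" for p
    using Suc.prems by (cases p) (simp add: arrive_node bind_return_pmf)
  with Suc show ?case
    by (simp add: target_def bind_return_pmf bind_map_pmf map_bind_pmf bind_assoc_pmf)
qed

text \<open>The law of the identity with which the behaviour policy enters layer
  \<open>k + 1\<close>.\<close>

primrec visited :: "nat set \<Rightarrow> nat \<Rightarrow> (nat \<times> bool) pmf" where
  "visited S 0 = labelled S"
| "visited S (Suc k) = bind_pmf (visited S k) (\<lambda>p. bind_pmf coin (\<lambda>a. if a = 1 then return_pmf p else fresh))"

lemma state_dist_behaviour: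
  "k < H \<Longrightarrow> state_dist (model s S) behaviour k = map_pmf to_nat (bind_pmf (visited S k) (arrive s S (Suc k)))"
proof (induction k)
  case 0
  then show ?case by (simp add: One_nat_def)
next
  case (Suc k)
  have "bind_pmf (arrive s S (Suc k) p) (\<lambda>x. bind_pmf (behaviour (to_nat x)) (\<lambda>a. map_pmf to_nat (step s S x a))) =
      bind_pmf coin (\<lambda>a. bind_pmf (if a = 1 then return_pmf p else fresh) (\<lambda>q. map_pmf to_nat (arrive s S (Suc (Suc k)) q)))" for p
    using Suc.prems
    by (cases p) (auto simp: arrive_node bind_return_pmf map_bind_pmf intro!: bind_pmf_cong)
  with Suc show ?case
    by (simp add: bind_map_pmf map_bind_pmf bind_assoc_pmf)
qed

text \<open>The left law has mass \<open>1/N\<close> on each good pair, the right one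
  \<open>1/(2N)\<close> on every pair.\<close>

lemma pmf_labelled_le_fresh: "pmf (labelled S) p \<le> 2 * pmf fresh p"
proof (cases "p \<in> set_pmf (labelled S)")
  case False
  then show ?thesis by (simp add: set_pmf_iff)
next
  case True
  then obtain i where i: "p = (i, i \<in> S)"
    by (auto simp: labelled_def)
  have ne: "{..<N} \<noteq> {}" using N_pos by (auto simp: lessThan_empty_iff)
  have "inj (\<lambda>i. (i, i \<in> S))" by (auto simp: inj_def)
  then have "pmf (labelled S) p = pmf (pmf_of_set {..<N}) i"
    unfolding labelled_def i by (rule pmf_map_inj')
  with True set_labelled[of S] show ?thesis
    using ne by (auto simp: i fresh_def card_cartesian_product)
qed

text \<open>The next law is the even mixture of the current one and \<open>fresh\<close>, and both
  dominate half of \<open>labelled S\<close>; hence the factor 2 does not grow with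
  \<open>k\<close>.\<close>

lemma pmf_labelled_le_visited: "pmf (labelled S) p \<le> 2 * pmf (visited S k) p"
proof (induction k)
  case 0
  then show ?case by simp
next
  case (Suc k)
  have "visited S (Suc k) = bind_pmf coin (\<lambda>a. if a = 1 then visited S k else fresh)"
    unfolding visited.simps
    by (subst bind_commute_pmf) (auto intro!: bind_pmf_cong simp: bind_return_pmf')
  then have "pmf (visited S (Suc k)) p = (pmf fresh p + pmf (visited S k) p) / 2"
    by (simp only: pmf_bind expectation_coin) simp
  with Suc pmf_labelled_le_fresh[of S p] show ?case by simp
qed

lemma Trap_notin_target: "Trap \<notin> set_pmf (bind_pmf (labelled S) (arrive s S h))"
  using Trap_notin_exit_pmf_good by (auto simp: arrive_def labelled_def split: if_splits)

text \<open>One factor 2 comes from the law of the identity, the other from the coin that chooses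
  action 1 at a node. In \<open>Trap\<close>, where the behaviour policy avoids action 1, the target
  has no mass.\<close>

lemma occ_target_le_behaviour:
  fixes x :: obs
  assumes "h \<in> {1..H}"
  shows "occ (model s S) target h (to_nat x) a \<le> 4 * occ (model s S) behaviour h (to_nat x) a"
proof -
  define e where "e = pmf (bind_pmf (labelled S) (arrive s S h)) x"
  define d where "d = pmf (bind_pmf (visited S (h - 1)) (arrive s S h)) x"
  have h: "h - 1 < H" "Suc (h - 1) = h"
    using assms by (auto simp: One_nat_def)
  have "e \<le> 2 * d"
    unfolding e_def d_def by (intro pmf_bind_mono pmf_labelled_le_visited) simp
  moreover have "0 \<le> d" by (simp add: d_def)
  moreover have "e = 0" if "x = Trap"
    using Trap_notin_target[of S s h] that unfolding e_def pmf_eq_0_set_pmf by simp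
  moreover have "occ (model s S) target h (to_nat x) a = e * pmf (return_pmf 1) a"
    by (simp add: occ_def state_dist_target[OF h(1)] h(2) e_def pmf_map_inj') (simp add: target_def)
  moreover have "occ (model s S) behaviour h (to_nat x) a = d * pmf (behaviour (to_nat x)) a"
    by (simp add: occ_def state_dist_behaviour[OF h(1)] h(2) d_def pmf_map_inj')
  moreover have "0 \<le> occ (model s S) behaviour h (to_nat x) a"
    by (simp add: occ_def)
  ultimately show ?thesis
    by (cases x; cases "a = 1") auto
qed

lemma concentrability_model: "concentrability (model s S) target behaviour \<le> 4"
  unfolding concentrability_def
proof (intro SUP_least)
  fix h x a assume h: "h \<in> {1..hor (model s S)}" and "x \<in> states (model s S)"
  then obtain y :: obs where y: "x = to_nat y" by auto
  let ?e = "occ (model s S) target h x a" and ?b = "occ (model s S) behaviour h x a"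
  have le: "?e \<le> 4 * ?b" and "0 \<le> ?e" "0 \<le> ?b"
    using occ_target_le_behaviour[of h s S y a] h by (simp_all add: y occ_def)
  then have "ereal (?e / ?b) \<le> ereal 4" if "?b \<noteq> 0"
    using that by (simp add: field_simps)
  with le \<open>0 \<le> ?e\<close> show "(if ?b = 0 then if ?e = 0 then 0 else \<infinity> else ereal (?e / ?b)) \<le> 4"
    by simp
qed

section \<open>Trajectory laws, layer by layer\<close>

definition tail :: "bool \<Rightarrow> nat set \<Rightarrow> nat \<Rightarrow> nat \<times> bool \<Rightarrow> trajectory pmf" where
  "tail s S h p = bind_pmf (arrive s S h p) (\<lambda>x. gen_traj (model s S) behaviour (Suc H - h) (to_nat x))"

lemma traj_dist_model: "traj_dist (model s S) behaviour = bind_pmf (labelled S) (tail s S 1)"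
  by (simp add: traj_dist_def tail_def[abs_def] bind_map_pmf bind_assoc_pmf)

text \<open>What the data record in the last layer. It does not mention the sign: in
  \<open>Trap\<close> the behaviour policy plays 0 and earns 0.\<close>

definition last_step :: "obs \<Rightarrow> trajectory" where
  "last_step x = (case x of Final c \<Rightarrow> [(to_nat x, 1, signum c)] | _ \<Rightarrow> [(to_nat x, 0, 0)])"

lemma tail_last: "tail s S H (i, b) = map_pmf last_step (exit_pmf s (b = (i \<in> S)))"
proof -
  have "gen_traj (model s S) behaviour (Suc 0) (to_nat x) = return_pmf (last_step x)"
    if "x \<in> set_pmf (exit_pmf s (b = (i \<in> S)))" for x
    using subsetD[OF set_exit_pmf that] by (auto simp: last_step_def bind_return_pmf)
  then show ?thesis
    unfolding tail_def map_pmf_def arrive_last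
    by (intro bind_pmf_cong refl) (simp add: Suc_diff_le)
qed

lemma tail_node:
  assumes "h < H"
  shows "tail s S h (i, b) = bind_pmf coin (\<lambda>a. map_pmf ((#) (to_nat (Node h i b), a, 0))
     (if a = 1 then tail s S (Suc h) (i, b) else bind_pmf fresh (tail s S (Suc h))))"
proof -
  have "Suc H - h = Suc (Suc H - Suc h)" using assms by simp
  then show ?thesis
    using assms
    by (auto simp: tail_def[abs_def] arrive_node bind_return_pmf map_bind_pmf bind_map_pmf bind_assoc_pmf
        intro!: bind_pmf_cong)
qed

lemma expectation_tail_last:
  "Ex (tail s S H (i, b)) f =
     (let g = (\<lambda>x. f (last_step x)) in
      ((if b = (i \<in> S) then 5 * g (Final s) else 4 * g Trap + g (Final s)) + 3 * g (Final (\<not> s))) / 8)"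
  by (simp add: tail_last expectation_exit_pmf)

lemma expectation_tail_node:
  assumes "h < H" "\<And>t. \<bar>f t\<bar> \<le> B"
  shows "Ex (tail s S h (i, b)) f =
    (Ex (tail s S (Suc h) (i, b)) (\<lambda>t. f ((to_nat (Node h i b), 1, 0) # t))
     + Ex fresh (\<lambda>p. Ex (tail s S (Suc h) p) (\<lambda>t. f ((to_nat (Node h i b), 0, 0) # t)))) / 2"
  using assms
  by (simp add: tail_node expectation_bind_pmf[where B = B] expectation_coin)

end

section \<open>Insensitivity of trajectories to the sign\<close>

context hidden_label_mdp
begin

abbreviation uniform :: "nat pmf" where
  "uniform \<equiv> pmf_of_set {..<N}"

lemma expectation_uniform: "Ex uniform f = (\<Sum>i<N. f i) / real N"
  using N_pos by (subst integral_pmf_of_set) (auto simp: lessThan_empty_iff)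

lemma set_uniform: "set_pmf uniform = {..<N}"
  using N_pos by (subst set_pmf_of_set) (auto simp: lessThan_empty_iff)

lemma expectation_fresh_index: "Ex fresh (\<lambda>p. f (fst p)) = Ex uniform f"
proof -
  have "Ex fresh (\<lambda>p. f (fst p)) = (\<Sum>p\<in>{..<N} \<times> (UNIV::bool set). f (fst p)) / real (N * 2)"
    unfolding fresh_def using N_pos
    by (subst integral_pmf_of_set) (auto simp: lessThan_empty_iff card_cartesian_product)
  also have "(\<Sum>p\<in>{..<N} \<times> (UNIV::bool set). f (fst p)) = (\<Sum>i<N. 2 * f i)"
    by (simp add: sum.cartesian_product' UNIV_bool)
  finally show ?thesis
    by (simp add: expectation_uniform sum_distrib_left[symmetric])
qed

lemma expectation_uniform_exceptional:
  assumes "0 \<le> y"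
  shows "Ex uniform (\<lambda>i. if i = j then x else y) \<le> max 0 x / real N + y"
proof -
  have "(\<Sum>i<N. if i = j then x else y) \<le> (\<Sum>i<N. (if i = j then max 0 x else 0) + y)"
    using assms by (intro sum_mono) auto
  also have "\<dots> \<le> max 0 x + real N * y"
    by (simp add: sum.distrib)
  finally show ?thesis
    using N_pos by (simp add: expectation_uniform field_simps)
qed

text \<open>The identity carried at the end of a trajectory is the current one with probability
  \<open>(1/2) ^ k\<close> and uniform otherwise, so bounds \<open>L i\<close> for the last layer propagate backwards
  as convex combinations of \<open>L i\<close> and their average.\<close>

lemma tail_difference:
  fixes W :: "'w pmf" and S1 S2 :: "'w \<Rightarrow> nat set" and L :: "nat \<Rightarrow> real"
  assumes cons: "\<And>\<Psi> z. C \<Psi> \<Longrightarrow> C (\<lambda>w t. \<Psi> w (z # t))"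
    and unit: "\<And>\<Psi> w t. C \<Psi> \<Longrightarrow> \<Psi> w t \<in> {0..1}"
    and last: "\<And>\<Psi> i b. C \<Psi> \<Longrightarrow> i < N \<Longrightarrow>
      \<bar>Ex W (\<lambda>w. Ex (tail s1 (S1 w) H (i, b)) (\<Psi> w) - Ex (tail s2 (S2 w) H (i, b)) (\<Psi> w))\<bar> \<le> L i"
    and L: "\<And>i. \<bar>L i\<bar> \<le> B"
    and "C \<Psi>" "k < H"
  shows "i < N \<Longrightarrow> \<bar>Ex W (\<lambda>w. Ex (tail s1 (S1 w) (H - k) (i, b)) (\<Psi> w) - Ex (tail s2 (S2 w) (H - k) (i, b)) (\<Psi> w))\<bar>
     \<le> (1/2) ^ k * L i + (1 - (1/2) ^ k) * Ex uniform L" (is "_ \<Longrightarrow> ?diff")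
    and "\<bar>Ex W (\<lambda>w. Ex fresh (\<lambda>p. Ex (tail s1 (S1 w) (H - k) p) (\<Psi> w))
            - Ex fresh (\<lambda>p. Ex (tail s2 (S2 w) (H - k) p) (\<Psi> w)))\<bar> \<le> Ex uniform L" (is ?avg)
proof -
  have E01: "Ex p (\<Psi> w) \<in> {0..1}" if "C \<Psi>" for p :: "trajectory pmf" and \<Psi> w
    using unit[OF that] by (rule expectation_unit)
  have fresh_diff: "\<bar>Ex W (\<lambda>w. Ex fresh (\<lambda>p. Ex (tail s1 (S1 w) h p) (\<Psi> w))
            - Ex fresh (\<lambda>p. Ex (tail s2 (S2 w) h p) (\<Psi> w)))\<bar> \<le> Ex uniform L"
    \<comment> \<open>The convex combination of \<open>L i\<close> and the mean of \<open>L\<close>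
      averages over a fresh index to the mean of \<open>L\<close>, whatever the weight
      \<open>c\<close>.\<close>
    if C: "C \<Psi>" and bound: "\<And>i b. i < N \<Longrightarrow>
      \<bar>Ex W (\<lambda>w. Ex (tail s1 (S1 w) h (i, b)) (\<Psi> w) - Ex (tail s2 (S2 w) h (i, b)) (\<Psi> w))\<bar>
        \<le> c * L i + (1 - c) * Ex uniform L" for \<Psi> h c
  proof -
    let ?d = "\<lambda>w p. Ex (tail s1 (S1 w) h p) (\<Psi> w) - Ex (tail s2 (S2 w) h p) (\<Psi> w)"
    have d: "\<bar>?d w p\<bar> \<le> 1" for w p
      using E01[OF C, of "tail s1 (S1 w) h p" w] E01[OF C, of "tail s2 (S2 w) h p" w] by auto
    have abs1: "\<bar>Ex p (\<Psi> w)\<bar> \<le> 1" for p :: "trajectory pmf" and w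
      using E01[OF C, of p w] by auto
    have "Ex W (\<lambda>w. Ex fresh (\<lambda>p. Ex (tail s1 (S1 w) h p) (\<Psi> w))
            - Ex fresh (\<lambda>p. Ex (tail s2 (S2 w) h p) (\<Psi> w))) = Ex W (\<lambda>w. Ex fresh (\<lambda>p. ?d w p))"
      by (simp add: Bochner_Integration.integral_diff integrable_pmf_bounded[OF abs1])
    also have "\<dots> = Ex fresh (\<lambda>p. Ex W (\<lambda>w. ?d w p))"
      by (rule expectation_swap[OF d])
    finally have eq: "Ex W (\<lambda>w. Ex fresh (\<lambda>p. Ex (tail s1 (S1 w) h p) (\<Psi> w))
            - Ex fresh (\<lambda>p. Ex (tail s2 (S2 w) h p) (\<Psi> w))) = Ex fresh (\<lambda>p. Ex W (\<lambda>w. ?d w p))" .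
    have "\<bar>Ex fresh (\<lambda>p. Ex W (\<lambda>w. ?d w p))\<bar> \<le> Ex fresh (\<lambda>p. c * L (fst p) + (1 - c) * Ex uniform L)"
    proof (rule expectation_abs_le_expectation)
      fix p assume "p \<in> set_pmf fresh"
      then show "\<bar>Ex W (\<lambda>w. ?d w p)\<bar> \<le> c * L (fst p) + (1 - c) * Ex uniform L"
        using bound[of "fst p" "snd p"] by (simp add: set_fresh mem_Times_iff)
    next
      fix p :: "nat \<times> bool"
      have "\<bar>c * L (fst p)\<bar> \<le> \<bar>c\<bar> * B"
        using L[of "fst p"] by (simp add: abs_mult mult_left_mono)
      then show "\<bar>c * L (fst p) + (1 - c) * Ex uniform L\<bar> \<le> \<bar>c\<bar> * B + \<bar>(1 - c) * Ex uniform L\<bar>"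
        by (rule order_trans[OF abs_triangle_ineq add_right_mono])
    qed
    also have "\<dots> = c * Ex fresh (\<lambda>p. L (fst p)) + (1 - c) * Ex uniform L"
      by (simp add: integrable_pmf_bounded[where f = "\<lambda>p. L (fst p)", OF L])
    also have "\<dots> = Ex uniform L"
      by (simp add: expectation_fresh_index algebra_simps)
    finally show ?thesis
      by (simp only: eq)
  qed
  have diff: "\<bar>Ex W (\<lambda>w. Ex (tail s1 (S1 w) (H - k) (i, b)) (\<Psi> w) - Ex (tail s2 (S2 w) (H - k) (i, b)) (\<Psi> w))\<bar>
     \<le> (1/2) ^ k * L i + (1 - (1/2) ^ k) * Ex uniform L" if "C \<Psi>" "i < N" "k < H" for \<Psi> i b k
    using that
  proof (induction k arbitrary: \<Psi> i b)
    case 0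
    then show ?case using last by simp
  next
    case (Suc k)
    define h where "h = H - Suc k"
    have h: "h < H" "Suc h = H - k" using Suc.prems by (simp_all add: h_def)
    \<comment> \<open>Prepending the recorded step yields functionals that are again in
      \<open>C\<close>, so the induction hypothesis applies one layer later.\<close>
    define \<Psi>1 where "\<Psi>1 = (\<lambda>w t. \<Psi> w ((to_nat (Node h i b), 1, 0) # t))"
    define \<Psi>0 where "\<Psi>0 = (\<lambda>w t. \<Psi> w ((to_nat (Node h i b), 0, 0) # t))"
    have C1: "C \<Psi>1" and C0: "C \<Psi>0"
      unfolding \<Psi>1_def \<Psi>0_def using Suc.prems by (auto intro: cons)
    let ?a = "\<lambda>s S w. Ex (tail s (S w) (H - k) (i, b)) (\<Psi>1 w)"
    let ?f = "\<lambda>s S w. Ex fresh (\<lambda>p. Ex (tail s (S w) (H - k) p) (\<Psi>0 w))"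
    have a: "\<bar>?a s S w\<bar> \<le> 1" and f: "\<bar>?f s S w\<bar> \<le> 1" for s S w
      using E01[OF C1, of "tail s (S w) (H - k) (i, b)" w]
        expectation_unit[of "\<lambda>p. Ex (tail s (S w) (H - k) p) (\<Psi>0 w)" fresh, OF E01[OF C0]]
      by auto
    have rec: "Ex (tail s (S w) h (i, b)) (\<Psi> w) = (?a s S w + ?f s S w) / 2" for s S w
    proof -
      have "\<bar>\<Psi> w t\<bar> \<le> 1" for t using unit[OF \<open>C \<Psi>\<close>, of w t] by simp
      then show ?thesis
        by (subst expectation_tail_node[OF h(1)]) (simp_all add: h \<Psi>1_def \<Psi>0_def)
    qed
    have eq: "Ex W (\<lambda>w. Ex (tail s1 (S1 w) h (i, b)) (\<Psi> w) - Ex (tail s2 (S2 w) h (i, b)) (\<Psi> w))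
        = (Ex W (\<lambda>w. ?a s1 S1 w - ?a s2 S2 w) + Ex W (\<lambda>w. ?f s1 S1 w - ?f s2 S2 w)) / 2"
      unfolding rec by (rule expectation_diff_half_sum[OF a a f f])
    have "\<bar>Ex W (\<lambda>w. ?a s1 S1 w - ?a s2 S2 w)\<bar> \<le> (1/2) ^ k * L i + (1 - (1/2) ^ k) * Ex uniform L"
      using Suc by (intro Suc.IH C1) auto
    moreover have "\<bar>Ex W (\<lambda>w. ?f s1 S1 w - ?f s2 S2 w)\<bar> \<le> Ex uniform L"
      using Suc by (intro fresh_diff[where c = "(1/2) ^ k"] C0 Suc.IH) auto
    ultimately have "\<bar>Ex W (\<lambda>w. Ex (tail s1 (S1 w) h (i, b)) (\<Psi> w) - Ex (tail s2 (S2 w) h (i, b)) (\<Psi> w))\<bar>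
       \<le> ((1/2) ^ k * L i + (1 - (1/2) ^ k) * Ex uniform L + Ex uniform L) / 2"
      unfolding eq by (rule abs_half_sum_le)
    also have "\<dots> = (1/2) ^ Suc k * L i + (1 - (1/2) ^ Suc k) * Ex uniform L"
      by (simp add: field_simps)
    finally show ?case unfolding h_def .
  qed
  show "i < N \<Longrightarrow> ?diff" by (rule diff[OF assms(5) _ assms(6)])
  show ?avg by (rule fresh_diff[OF assms(5) diff[OF assms(5) _ assms(6)]])
qed

section \<open>Averaging over a random label set\<close>

abbreviation labels :: "nat set pmf" where
  "labels \<equiv> pmf_of_set (Pow {..<N})"

lemma expectation_labels_flip:
  assumes "i < N"
  shows "Ex labels (\<lambda>S. f (flip i S)) = Ex labels f"
proof -
  have "Ex (map_pmf (flip i) labels) f = Ex labels f"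
    by (simp only: map_flip_uniform[OF assms])
  then show ?thesis by simp
qed

text \<open>Averaged over the label of the final identity, the exit law does not depend on \<open>s\<close>.\<close>

lemma tail_last_sign_difference:
  assumes unit: "\<And>S t. \<Psi> S t \<in> {0..1}"
    and lip: "\<And>S t. \<bar>\<Psi> S t - \<Psi> (flip i S) t\<bar> \<le> L"
    and i: "i < N"
  shows "\<bar>Ex labels (\<lambda>S. Ex (tail True S H (i, b)) (\<Psi> S) - Ex (tail False S H (i, b)) (\<Psi> S))\<bar> \<le> L"
proof -
  let ?F = "\<lambda>S. Ex (tail True S H (i, b)) (\<Psi> S) - Ex (tail False S H (i, b)) (\<Psi> S)"
  \<comment> \<open>Between the two signs the \<open>Trap\<close> terms cancel, and good and bad
    exits change by opposite amounts \<open>g S\<close> and \<open>- g S\<close>.\<close>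
  define g where "g S = (\<Psi> S (last_step (Final True)) - \<Psi> S (last_step (Final False))) / 4" for S
  have F: "?F S = (if b = (i \<in> S) then g S else - g S)" for S
    by (simp add: expectation_tail_last g_def Let_def field_simps)
  have g: "\<bar>g S\<bar> \<le> 1" for S
    using unit[of S "last_step (Final True)"] unit[of S "last_step (Final False)"] by (auto simp: g_def)
  then have F1: "\<bar>?F S\<bar> \<le> 1" for S
    unfolding F by auto
  \<comment> \<open>A flip at \<open>i\<close> exchanges good and bad for this identity. The two
    contributions then cancel up to the change of \<open>\<Psi>\<close> itself.\<close>
  have pair: "\<bar>?F S + ?F (flip i S)\<bar> \<le> L" for S
  proof -
    define x where "x = \<Psi> S (last_step (Final True)) - \<Psi> (flip i S) (last_step (Final True))"
    define y where "y = \<Psi> S (last_step (Final False)) - \<Psi> (flip i S) (last_step (Final False))"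
    have "\<bar>x\<bar> \<le> L" "\<bar>y\<bar> \<le> L" unfolding x_def y_def by (rule lip)+
    moreover have "g S - g (flip i S) = (x - y) / 4"
      by (simp add: g_def x_def y_def field_simps)
    ultimately have "\<bar>g S - g (flip i S)\<bar> \<le> L"
      using abs_triangle_ineq4[of x y] by simp
    then show ?thesis unfolding F by (auto simp: mem_flip)
  qed
  have "2 * Ex labels ?F = Ex labels ?F + Ex labels (\<lambda>S. ?F (flip i S))"
    using expectation_labels_flip[OF i, of ?F] by simp
  also have "\<dots> = Ex labels (\<lambda>S. ?F S + ?F (flip i S))"
    by (rule Bochner_Integration.integral_add[symmetric]) (rule integrable_pmf_bounded[OF F1])+
  finally have eq: "2 * Ex labels ?F = Ex labels (\<lambda>S. ?F S + ?F (flip i S))" .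
  have "\<bar>2 * Ex labels ?F\<bar> \<le> L"
    unfolding eq by (rule expectation_abs_le) (rule pair)
  then show ?thesis by (simp add: abs_mult)
qed

text \<open>The starting identity is good for every \<open>S\<close>, so averaging over its label
  does not hide the sign. With probability \<open>(1/2)^k\<close> it is kept to the end and the
  exits differ by at most 1/4. Otherwise a redraw leads to an index whose label is still averaged
  out, up to \<open>\<delta>\<close>, unless it is \<open>j\<close> again, which costs
  \<open>1/N\<close>. Insensitivity is assumed only away from \<open>j\<close> because the recorded
  prefix reveals the label of \<open>j\<close>.\<close>

lemma start_sign_difference:
  assumes unit: "\<And>S t. \<Psi> S t \<in> {0..1}"
    and lip: "\<And>i S t. i < N \<Longrightarrow> i \<noteq> j \<Longrightarrow> \<bar>\<Psi> S t - \<Psi> (flip i S) t\<bar> \<le> \<delta>"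
    and "k < H" "0 \<le> \<delta>"
  shows "\<bar>Ex labels (\<lambda>S. Ex (tail True S (H - k) (j, j \<in> S)) (\<Psi> S)
            - Ex (tail False S (H - k) (j, j \<in> S)) (\<Psi> S))\<bar> \<le> (1/2) ^ k / 4 + \<delta> + 1 / real N"
  using assms(1-3)
proof (induction k arbitrary: \<Psi>)
  case 0
  have "\<bar>Ex (tail True S H (j, j \<in> S)) (\<Psi> S) - Ex (tail False S H (j, j \<in> S)) (\<Psi> S)\<bar> \<le> 1 / 4" for S
  proof -
    have eq: "Ex (tail True S H (j, j \<in> S)) (\<Psi> S) - Ex (tail False S H (j, j \<in> S)) (\<Psi> S)
      = (\<Psi> S (last_step (Final True)) - \<Psi> S (last_step (Final False))) / 4"
      by (simp add: expectation_tail_last Let_def field_simps)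
    show ?thesis
      unfolding eq
      using "0.prems"(1)[of S "last_step (Final True)"] "0.prems"(1)[of S "last_step (Final False)"]
      by auto
  qed
  then have "\<bar>Ex labels (\<lambda>S. Ex (tail True S H (j, j \<in> S)) (\<Psi> S) - Ex (tail False S H (j, j \<in> S)) (\<Psi> S))\<bar> \<le> 1 / 4"
    by (rule expectation_abs_le)
  then show ?case
    using \<open>0 \<le> \<delta>\<close> by (simp add: add_increasing2)
next
  case (Suc k)
  define h where "h = H - Suc k"
  have h: "h < H" "Suc h = H - k" using Suc.prems by (simp_all add: h_def)
  define \<Psi>1 where "\<Psi>1 = (\<lambda>S t. \<Psi> S ((to_nat (Node h j (j \<in> S)), 1, 0) # t))"
  define \<Psi>0 where "\<Psi>0 = (\<lambda>S t. \<Psi> S ((to_nat (Node h j (j \<in> S)), 0, 0) # t))"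
  have unit1: "\<Psi>1 S t \<in> {0..1}" and unit0: "\<Psi>0 S t \<in> {0..1}" for S t
    unfolding \<Psi>1_def \<Psi>0_def by (rule Suc.prems(1))+
  have lip1: "\<bar>\<Psi>1 S t - \<Psi>1 (flip i S) t\<bar> \<le> \<delta>" and lip0: "\<bar>\<Psi>0 S t - \<Psi>0 (flip i S) t\<bar> \<le> \<delta>"
    if "i < N" "i \<noteq> j" for i S t
    using that Suc.prems(2)[OF that] by (simp_all add: \<Psi>1_def \<Psi>0_def mem_flip)
  let ?a = "\<lambda>s S. Ex (tail s S (H - k) (j, j \<in> S)) (\<Psi>1 S)"
  let ?f = "\<lambda>s S. Ex fresh (\<lambda>p. Ex (tail s S (H - k) p) (\<Psi>0 S))"
  have E0: "Ex p (\<Psi>0 S) \<in> {0..1}" and E1: "Ex p (\<Psi>1 S) \<in> {0..1}" for p S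
    by (intro expectation_unit unit0 unit1)+
  have a: "\<bar>?a s S\<bar> \<le> 1" and f: "\<bar>?f s S\<bar> \<le> 1" for s S
    using E1[of "tail s S (H - k) (j, j \<in> S)" S]
      expectation_unit[of "\<lambda>p. Ex (tail s S (H - k) p) (\<Psi>0 S)" fresh, OF E0]
    by auto
  have rec: "Ex (tail s S h (j, j \<in> S)) (\<Psi> S) = (?a s S + ?f s S) / 2" for s S
  proof -
    have "\<bar>\<Psi> S t\<bar> \<le> 1" for t using Suc.prems(1)[of S t] by simp
    then show ?thesis
      by (subst expectation_tail_node[OF h(1)]) (simp_all add: h \<Psi>1_def \<Psi>0_def)
  qed
  have eq: "Ex labels (\<lambda>S. Ex (tail True S h (j, j \<in> S)) (\<Psi> S) - Ex (tail False S h (j, j \<in> S)) (\<Psi> S))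
      = (Ex labels (\<lambda>S. ?a True S - ?a False S) + Ex labels (\<lambda>S. ?f True S - ?f False S)) / 2"
    unfolding rec by (rule expectation_diff_half_sum[OF a a f f])
  have A: "\<bar>Ex labels (\<lambda>S. ?a True S - ?a False S)\<bar> \<le> (1/2) ^ k / 4 + \<delta> + 1 / real N"
    using Suc.prems(3) by (intro Suc.IH unit1 lip1) auto
  \<comment> \<open>At \<open>j\<close> only the trivial bound 1 is available.\<close>
  define L where "L = (\<lambda>i. if i = j then 1 else \<delta>)"
  define C where "C \<Phi> \<longleftrightarrow> (\<forall>S t. \<Phi> S t \<in> {0..1}) \<and>
      (\<forall>i<N. \<forall>S t. \<bar>\<Phi> S t - \<Phi> (flip i S) t\<bar> \<le> L i)" for \<Phi> :: "nat set \<Rightarrow> trajectory \<Rightarrow> real"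
  have "\<bar>\<Psi>0 S t - \<Psi>0 (flip j S) t\<bar> \<le> 1" for S t
    using unit0[of S t] unit0[of "flip j S" t] by auto
  then have "C \<Psi>0"
    using unit0 lip0 by (simp add: C_def L_def)
  have "\<bar>Ex labels (\<lambda>S. ?f True S - ?f False S)\<bar> \<le> Ex uniform L"
  proof (rule tail_difference(2)[where C = C and B = "1 + \<delta>"])
    fix \<Phi> i b assume "C \<Phi>" "i < N"
    then show "\<bar>Ex labels (\<lambda>S. Ex (tail True S H (i, b)) (\<Phi> S) - Ex (tail False S H (i, b)) (\<Phi> S))\<bar> \<le> L i"
      by (intro tail_last_sign_difference) (auto simp: C_def)
  qed (use \<open>C \<Psi>0\<close> \<open>0 \<le> \<delta>\<close> Suc.prems(3) N_pos in \<open>auto simp: C_def L_def\<close>)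
  also have "\<dots> \<le> 1 / real N + \<delta>"
    using expectation_uniform_exceptional[OF \<open>0 \<le> \<delta>\<close>, of j 1] by (simp add: L_def)
  finally have "\<bar>Ex labels (\<lambda>S. Ex (tail True S h (j, j \<in> S)) (\<Psi> S) - Ex (tail False S h (j, j \<in> S)) (\<Psi> S))\<bar>
      \<le> (((1/2) ^ k / 4 + \<delta> + 1 / real N) + (1 / real N + \<delta>)) / 2"
    unfolding eq by (rule abs_half_sum_le[OF A])
  also have "\<dots> = (1/2) ^ Suc k / 4 + \<delta> + 1 / real N"
    by (simp add: field_simps)
  finally show ?case unfolding h_def .
qed

text \<open>The two exit laws differ only at index \<open>i\<close>, so the difference is at most
  the chance of being redrawn to \<open>i\<close>. The averaging over \<open>W\<close> is trivial
  here.\<close>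

lemma tail_flip_difference:
  assumes unit: "\<And>t. f t \<in> {0..1}" and "j < N" "j \<noteq> i" "k < H"
  shows "\<bar>Ex (tail s S (H - k) (j, b)) f - Ex (tail s (flip i S) (H - k) (j, b)) f\<bar> \<le> 1 / real N"
proof -
  define L where "L = (\<lambda>l. if l = i then 1 else 0 :: real)"
  define C where "C \<Phi> \<longleftrightarrow> (\<forall>w t. \<Phi> w t \<in> {0..1})" for \<Phi> :: "unit \<Rightarrow> trajectory \<Rightarrow> real"
  have avg: "Ex uniform L \<le> 1 / real N" "0 \<le> Ex uniform L"
    using expectation_uniform_exceptional[of 0 i 1] by (simp_all add: L_def expectation_uniform sum_nonneg)
  have "\<bar>Ex (return_pmf ()) (\<lambda>w. Ex (tail s S (H - k) (j, b)) f - Ex (tail s (flip i S) (H - k) (j, b)) f)\<bar>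
      \<le> (1/2) ^ k * L j + (1 - (1/2) ^ k) * Ex uniform L"
  proof (rule tail_difference(1)[where C = C and B = 1 and \<Psi> = "\<lambda>_. f"])
    fix \<Phi> :: "unit \<Rightarrow> trajectory \<Rightarrow> real" and l b assume "C \<Phi>" "l < N"
    then have "Ex p (\<Phi> w) \<in> {0..1}" for p w
      by (intro expectation_unit) (auto simp: C_def)
    then have "\<bar>Ex p (\<Phi> w) - Ex q (\<Phi> w)\<bar> \<le> 1" for p q w
      by (smt (verit) atLeastAtMost_iff)
    moreover have "tail s (flip i S) H (l, b) = tail s S H (l, b)" if "l \<noteq> i"
      using that by (simp add: tail_last mem_flip)
    ultimately show "\<bar>Ex (return_pmf ()) (\<lambda>w. Ex (tail s S H (l, b)) (\<Phi> w) - Ex (tail s (flip i S) H (l, b)) (\<Phi> w))\<bar> \<le> L l"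
      by (auto simp: L_def)
  qed (use assms in \<open>auto simp: C_def L_def\<close>)
  also have "\<dots> \<le> 1 * Ex uniform L"
    using assms avg by (simp add: L_def mult_left_le_one_le power_le_one)
  finally show ?thesis
    using avg by simp
qed

section \<open>Whole trajectories: effect of a label flip and of the sign\<close>

abbreviation traj :: "bool \<Rightarrow> nat set \<Rightarrow> trajectory pmf" where
  "traj s S \<equiv> traj_dist (model s S) behaviour"

lemma expectation_traj:
  assumes "\<And>t. f t \<in> {0..1}"
  shows "Ex (traj s S) f = Ex uniform (\<lambda>j. Ex (tail s S 1 (j, j \<in> S)) f)"
proof -
  have "\<bar>f t\<bar> \<le> 1" for t using assms[of t] by simp
  then show ?thesis
    by (simp add: traj_dist_model labelled_def bind_map_pmf expectation_bind_pmf[where B = 1])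
qed

text \<open>One \<open>1/N\<close> pays for starting at index \<open>i\<close>, the other for being
  redrawn to it later.\<close>

lemma traj_flip_difference:
  assumes unit: "\<And>t. f t \<in> {0..1}"
  shows "\<bar>Ex (traj s S) f - Ex (traj s (flip i S)) f\<bar> \<le> 2 / real N"
proof -
  let ?d = "\<lambda>j. Ex (tail s S 1 (j, j \<in> S)) f - Ex (tail s (flip i S) 1 (j, j \<in> flip i S)) f"
  have E: "Ex p f \<in> {0..1}" for p by (intro expectation_unit unit)
  then have E1: "\<bar>Ex p f\<bar> \<le> 1" and d: "\<bar>Ex p f - Ex q f\<bar> \<le> 1" for p q
    by (smt (verit) atLeastAtMost_iff)+
  have "Ex (traj s S) f - Ex (traj s (flip i S)) f = Ex uniform ?d"
    by (simp add: expectation_traj[OF unit] integrable_pmf_bounded[OF E1])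
  also have "\<bar>\<dots>\<bar> \<le> Ex uniform (\<lambda>j. if j = i then 1 else 1 / real N)"
  proof (rule expectation_abs_le_expectation)
    fix j assume "j \<in> set_pmf uniform"
    then show "\<bar>?d j\<bar> \<le> (if j = i then 1 else 1 / real N)"
      using d tail_flip_difference[OF unit, of j i "H - 1" s S "j \<in> S"] H_pos
      by (simp add: set_uniform mem_flip)
  next
    show "\<bar>if j = i then 1 else 1 / real N\<bar> \<le> 1" for j
      using N_pos by simp
  qed
  also have "\<dots> \<le> 1 / real N + 1 / real N"
    using expectation_uniform_exceptional[of "1 / real N" i 1] by simp
  finally show ?thesis by simp
qed

lemma traj_sign_difference:
  assumes unit: "\<And>S t. \<Psi> S t \<in> {0..1}"
    and lip: "\<And>i S t. i < N \<Longrightarrow> \<bar>\<Psi> S t - \<Psi> (flip i S) t\<bar> \<le> \<delta>" and "0 \<le> \<delta>"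
  shows "\<bar>Ex labels (\<lambda>S. Ex (traj True S) (\<Psi> S) - Ex (traj False S) (\<Psi> S))\<bar>
     \<le> (1/2) ^ (H - 1) / 4 + \<delta> + 1 / real N"
proof -
  let ?d = "\<lambda>S j. Ex (tail True S 1 (j, j \<in> S)) (\<Psi> S) - Ex (tail False S 1 (j, j \<in> S)) (\<Psi> S)"
  have E: "Ex p (\<Psi> S) \<in> {0..1}" for p S by (intro expectation_unit unit)
  then have E1: "\<bar>Ex p (\<Psi> S)\<bar> \<le> 1" and d: "\<bar>?d S j\<bar> \<le> 1" for p S j
    by (smt (verit) atLeastAtMost_iff)+
  have "Ex labels (\<lambda>S. Ex (traj True S) (\<Psi> S) - Ex (traj False S) (\<Psi> S)) = Ex labels (\<lambda>S. Ex uniform (?d S))"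
    by (simp add: expectation_traj[OF unit] integrable_pmf_bounded[OF E1])
  also have "\<dots> = Ex uniform (\<lambda>j. Ex labels (\<lambda>S. ?d S j))"
    by (rule expectation_swap[OF d])
  also have "\<bar>\<dots>\<bar> \<le> (1/2) ^ (H - 1) / 4 + \<delta> + 1 / real N"
    using start_sign_difference[where \<Psi> = \<Psi> and \<delta> = \<delta> and k = "H - 1"] unit lip H_pos \<open>0 \<le> \<delta>\<close>
    by (intro expectation_abs_le[of uniform]) auto
  finally show ?thesis .
qed

end

section \<open>Data sets and the two-point argument\<close>

lemma expectation_iid_Suc:
  assumes "\<And>xs. f xs \<in> {0..1}"
  shows "Ex (iid_pmf (Suc n) p) f = Ex p (\<lambda>x. Ex (iid_pmf n p) (\<lambda>xs. f (x # xs)))"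
proof -
  have "\<bar>f xs\<bar> \<le> 1" for xs using assms[of xs] by simp
  then show ?thesis by (simp add: expectation_bind_pmf[where B = 1])
qed

text \<open>Hybrid argument: samples from \<open>p\<close> are exchanged for samples from
  \<open>q\<close> one at a time, each at cost \<open>\<kappa>\<close>.\<close>

lemma iid_difference:
  assumes pq: "\<And>f. (\<And>x. f x \<in> {0..1}) \<Longrightarrow> \<bar>Ex p f - Ex q f\<bar> \<le> \<kappa>"
    and unit: "\<And>xs. f xs \<in> {0..1}"
  shows "\<bar>Ex (iid_pmf n p) f - Ex (iid_pmf n q) f\<bar> \<le> real n * \<kappa>"
  using unit
proof (induction n arbitrary: f)
  case (Suc n)
  let ?g = "\<lambda>r x. Ex (iid_pmf n r) (\<lambda>xs. f (x # xs))"
  have g: "?g r x \<in> {0..1}" for r x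
    by (intro expectation_unit Suc.prems)
  have g1: "\<bar>?g r x\<bar> \<le> 1" for r x using g[of r x] by simp
  have "\<bar>Ex p (?g p) - Ex p (?g q)\<bar> = \<bar>Ex p (\<lambda>x. ?g p x - ?g q x)\<bar>"
    by (simp add: integrable_pmf_bounded[OF g1])
  also have "\<dots> \<le> real n * \<kappa>"
    by (intro expectation_abs_le Suc.IH Suc.prems)
  finally have "\<bar>Ex p (?g p) - Ex p (?g q)\<bar> \<le> real n * \<kappa>" .
  moreover have "\<bar>Ex p (?g q) - Ex q (?g q)\<bar> \<le> \<kappa>"
    by (intro pq g)
  ultimately have "\<bar>Ex p (?g p) - Ex q (?g q)\<bar> \<le> real n * \<kappa> + \<kappa>"
    unfolding abs_le_iff by linarith
  then show ?case
    unfolding expectation_iid_Suc[OF Suc.prems] by (simp add: algebra_simps)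
qed simp

context hidden_label_mdp
begin

text \<open>Hybrid argument on average over \<open>S\<close>: first the sign of the first trajectory
  is changed, then, by induction, that of the others. Integrating out trajectories worsens the flip
  sensitivity, since their law also depends on \<open>S\<close>, by \<open>2/N\<close> each; hence
  the induction is over all \<open>\<delta>\<close>.\<close>

lemma iid_sign_difference:
  assumes unit: "\<And>S d. \<Psi> S d \<in> {0..1}"
    and lip: "\<And>i S d. i < N \<Longrightarrow> \<bar>\<Psi> S d - \<Psi> (flip i S) d\<bar> \<le> \<delta>" and "0 \<le> \<delta>"
  shows "\<bar>Ex labels (\<lambda>S. Ex (iid_pmf n (traj True S)) (\<Psi> S) - Ex (iid_pmf n (traj False S)) (\<Psi> S))\<bar>
     \<le> real n * ((1/2) ^ (H - 1) / 4 + \<delta> + 1 / real N + real n * (2 / real N))"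
  using assms
proof (induction n arbitrary: \<Psi> \<delta>)
  case (Suc n)
  note unit = Suc.prems(1) and lip = Suc.prems(2)
  let ?\<kappa> = "2 / real N"
  let ?c = "(1/2) ^ (H - 1) / 4 + \<delta> + 1 / real N + real (Suc n) * ?\<kappa>"
  \<comment> \<open>\<open>\<Phi>\<close> integrates out the other \<open>n\<close> trajectories
    under sign \<open>True\<close>, \<open>\<Theta>\<close> the first one under sign
    \<open>False\<close>. The middle hybrid can be read as the mean of either.\<close>
  define \<Phi> where "\<Phi> = (\<lambda>S t. Ex (iid_pmf n (traj True S)) (\<lambda>d. \<Psi> S (t # d)))"
  define \<Theta> where "\<Theta> = (\<lambda>S d. Ex (traj False S) (\<lambda>t. \<Psi> S (t # d)))"
  have \<Phi>: "\<Phi> S t \<in> {0..1}" and \<Theta>: "\<Theta> S d \<in> {0..1}" for S t d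
    unfolding \<Phi>_def \<Theta>_def by (intro expectation_unit unit)+
  have \<Psi>1: "\<bar>\<Psi> S d\<bar> \<le> 1" for S d using unit[of S d] by simp
  have flip_\<Psi>: "\<bar>Ex p (\<lambda>x. \<Psi> S (g x)) - Ex p (\<lambda>x. \<Psi> (flip i S) (g x))\<bar> \<le> \<delta>"
    if "i < N" for p :: "'b pmf" and g S i
  proof -
    have "\<bar>Ex p (\<lambda>x. \<Psi> S (g x) - \<Psi> (flip i S) (g x))\<bar> \<le> \<delta>"
      by (intro expectation_abs_le lip that)
    then show ?thesis by (simp add: integrable_pmf_bounded[OF \<Psi>1])
  qed
  have lip\<Phi>: "\<bar>\<Phi> S t - \<Phi> (flip i S) t\<bar> \<le> \<delta> + real n * ?\<kappa>" if i: "i < N" for i S t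
  proof -
    have "\<bar>\<Phi> S t - Ex (iid_pmf n (traj True S)) (\<lambda>d. \<Psi> (flip i S) (t # d))\<bar> \<le> \<delta>"
      unfolding \<Phi>_def by (rule flip_\<Psi>[OF i])
    moreover have "\<bar>Ex (iid_pmf n (traj True S)) (\<lambda>d. \<Psi> (flip i S) (t # d)) - \<Phi> (flip i S) t\<bar> \<le> real n * ?\<kappa>"
      unfolding \<Phi>_def by (intro iid_difference traj_flip_difference unit)
    ultimately show ?thesis unfolding abs_le_iff by linarith
  qed
  have lip\<Theta>: "\<bar>\<Theta> S d - \<Theta> (flip i S) d\<bar> \<le> \<delta> + ?\<kappa>" if i: "i < N" for i S d
  proof -
    have "\<bar>\<Theta> S d - Ex (traj False S) (\<lambda>t. \<Psi> (flip i S) (t # d))\<bar> \<le> \<delta>"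
      unfolding \<Theta>_def by (rule flip_\<Psi>[OF i])
    moreover have "\<bar>Ex (traj False S) (\<lambda>t. \<Psi> (flip i S) (t # d)) - \<Theta> (flip i S) d\<bar> \<le> ?\<kappa>"
      unfolding \<Theta>_def by (intro traj_flip_difference unit)
    ultimately show ?thesis unfolding abs_le_iff by linarith
  qed
  have "\<bar>Ex labels (\<lambda>S. Ex (traj True S) (\<Phi> S) - Ex (traj False S) (\<Phi> S))\<bar>
      \<le> (1/2) ^ (H - 1) / 4 + (\<delta> + real n * ?\<kappa>) + 1 / real N"
    using Suc.prems(3) by (intro traj_sign_difference \<Phi> lip\<Phi>) auto
  also have "\<dots> \<le> ?c"
    using mult_right_mono[of "real n" "real (Suc n)" ?\<kappa>] by simp
  finally have first: "\<bar>Ex labels (\<lambda>S. Ex (traj True S) (\<Phi> S) - Ex (traj False S) (\<Phi> S))\<bar> \<le> ?c" .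
  have "\<bar>Ex labels (\<lambda>S. Ex (iid_pmf n (traj True S)) (\<Theta> S) - Ex (iid_pmf n (traj False S)) (\<Theta> S))\<bar>
      \<le> real n * ((1/2) ^ (H - 1) / 4 + (\<delta> + ?\<kappa>) + 1 / real N + real n * ?\<kappa>)"
    using Suc.prems(3) by (intro Suc.IH \<Theta> lip\<Theta>) auto
  also have "\<dots> = real n * ?c"
    by (simp add: algebra_simps add_divide_distrib)
  finally have rest: "\<bar>Ex labels (\<lambda>S. Ex (iid_pmf n (traj True S)) (\<Theta> S) - Ex (iid_pmf n (traj False S)) (\<Theta> S))\<bar>
      \<le> real n * ?c" .
  have swap: "Ex (iid_pmf n p) (\<Theta> S) = Ex (traj False S) (\<lambda>t. Ex (iid_pmf n p) (\<lambda>d. \<Psi> S (t # d)))" for p S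
    unfolding \<Theta>_def by (rule expectation_swap[OF \<Psi>1])
  have split: "Ex (iid_pmf (Suc n) (traj True S)) (\<Psi> S) - Ex (iid_pmf (Suc n) (traj False S)) (\<Psi> S)
     = (Ex (traj True S) (\<Phi> S) - Ex (traj False S) (\<Phi> S)) +
       (Ex (iid_pmf n (traj True S)) (\<Theta> S) - Ex (iid_pmf n (traj False S)) (\<Theta> S))" for S
    unfolding expectation_iid_Suc[OF unit] swap by (simp add: \<Phi>_def)
  have b1: "\<bar>Ex p (\<Phi> S)\<bar> \<le> 1" and b2: "\<bar>Ex q (\<Theta> S)\<bar> \<le> 1" for p q S
    using expectation_unit[of "\<Phi> S" p, OF \<Phi>] expectation_unit[of "\<Theta> S" q, OF \<Theta>] by auto
  have "Ex labels (\<lambda>S. Ex (iid_pmf (Suc n) (traj True S)) (\<Psi> S) - Ex (iid_pmf (Suc n) (traj False S)) (\<Psi> S))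
     = Ex labels (\<lambda>S. Ex (traj True S) (\<Phi> S) - Ex (traj False S) (\<Phi> S)) +
       Ex labels (\<lambda>S. Ex (iid_pmf n (traj True S)) (\<Theta> S) - Ex (iid_pmf n (traj False S)) (\<Theta> S))"
    unfolding split
    by (intro Bochner_Integration.integral_add Bochner_Integration.integrable_diff
        integrable_pmf_bounded[OF b1] integrable_pmf_bounded[OF b2])
  with first rest have "\<bar>Ex labels (\<lambda>S. Ex (iid_pmf (Suc n) (traj True S)) (\<Psi> S) - Ex (iid_pmf (Suc n) (traj False S)) (\<Psi> S))\<bar>
     \<le> ?c + real n * ?c"
    by (smt (verit))
  also have "\<dots> = real (Suc n) * ?c"
    by (simp only: of_nat_Suc distrib_right mult_1_left)
  finally show ?case .
qed simp

text \<open>Le Cam's two-point argument with the test function \<open>min 1 (2 \<integral> |v - 1/4|)\<close>: since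
  \<open>|v - 1/4| + |v + 1/4| \<ge> 1/2\<close>, an accurate algorithm makes its mean small for
  \<open>s = True\<close> and close to 1 for \<open>s = False\<close>.\<close>

lemma ope_error_lower_bound:
  assumes err: "\<And>s S. S \<subseteq> {..<N} \<Longrightarrow> ope_error alg n (problem s S) \<le> ennreal e" and "0 \<le> e"
  shows "1 - 4 * e \<le> real n * ((1/2) ^ (H - 1) / 4 + 1 / real N + real n * (2 / real N))"
proof -
  let ?D = "\<lambda>s S. iid_pmf n (traj s S)"
  define E where "E s d = (\<integral>\<^sup>+v. ennreal \<bar>v - signum s / 4\<bar> \<partial>measure_pmf (alg target (range Qfun) d))" for s d
  \<comment> \<open>The error \<open>E s d\<close> may be infinite, so it is capped before the
    passage to reals.\<close>
  define T where "T s d = enn2real (min 1 (2 * E s d))" for s d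
  have T01: "T s d \<in> {0..1}" for s d
    by (auto simp: T_def intro: enn2real_leI)
  have eT: "ennreal (T s d) = min 1 (2 * E s d)" for s d
    unfolding T_def by (rule ennreal_enn2real) (simp add: min_less_iff_disj)
  have sum1: "1 \<le> T True d + T False d" for d
  proof -
    have "ennreal (1/2) = (\<integral>\<^sup>+v. ennreal (1/2) \<partial>measure_pmf (alg target (range Qfun) d))"
      by simp
    also have "\<dots> \<le> (\<integral>\<^sup>+v. ennreal \<bar>v - signum True / 4\<bar> + ennreal \<bar>v - signum False / 4\<bar>
        \<partial>measure_pmf (alg target (range Qfun) d))"
    proof (intro nn_integral_mono)
      fix v :: real
      have "1/2 \<le> \<bar>v - signum True / 4\<bar> + \<bar>v - signum False / 4\<bar>"
        by (simp add: signum_def abs_if)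
      then have "ennreal (1/2) \<le> ennreal (\<bar>v - signum True / 4\<bar> + \<bar>v - signum False / 4\<bar>)"
        by (rule ennreal_leI)
      then show "ennreal (1/2) \<le> ennreal \<bar>v - signum True / 4\<bar> + ennreal \<bar>v - signum False / 4\<bar>"
        by (simp only: ennreal_plus abs_ge_zero)
    qed
    also have "\<dots> = E True d + E False d"
      unfolding E_def by (intro nn_integral_add) auto
    finally have "2 * ennreal (1/2) \<le> 2 * (E True d + E False d)"
      by (rule mult_left_mono) simp
    moreover have "2 * ennreal (1/2) = 1"
      using ennreal_mult[of 2 "1/2"] by simp
    ultimately have "1 \<le> 2 * E True d + 2 * E False d"
      by (simp add: distrib_left)
    then have "1 \<le> min 1 (2 * E True d) + min 1 (2 * E False d)"
      by (auto simp: min_def add_increasing add_increasing2)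
    then have "ennreal 1 \<le> ennreal (T True d + T False d)"
      using T01 by (simp add: eT ennreal_plus)
    then show ?thesis
      using T01[of True d] T01[of False d] by (subst (asm) ennreal_le_iff) auto
  qed
  have T_le: "Ex (?D s S) (T s) \<le> 2 * e" if "S \<subseteq> {..<N}" for s S
  proof -
    have "ennreal (Ex (?D s S) (T s)) = (\<integral>\<^sup>+d. ennreal (T s d) \<partial>?D s S)"
      using T01[of s] by (intro nn_integral_eq_integral[symmetric] integrable_pmf_bounded[where B = 1]) auto
    also have "\<dots> \<le> (\<integral>\<^sup>+d. 2 * E s d \<partial>?D s S)"
      by (intro nn_integral_mono) (simp add: eT)
    also have "\<dots> = 2 * (\<integral>\<^sup>+d. E s d \<partial>?D s S)"
      by (intro nn_integral_cmult) auto
    also have "(\<integral>\<^sup>+d. E s d \<partial>?D s S) = ope_error alg n (problem s S)"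
      by (simp add: ope_error_def problem_def Vpi_model E_def)
    also have "2 * \<dots> \<le> 2 * ennreal e"
      using err[OF that] by (rule mult_left_mono) simp
    also have "2 * ennreal e = ennreal (2 * e)"
      using \<open>0 \<le> e\<close> by (simp add: ennreal_mult)
    finally show ?thesis
      using \<open>0 \<le> e\<close> by simp
  qed
  \<comment> \<open>Under sign \<open>False\<close> the test \<open>T False\<close> has mean at most
    \<open>2 * e\<close>, so \<open>T True\<close> has mean at least \<open>1 - 2 * e\<close>; under
    sign \<open>True\<close> it has mean at most \<open>2 * e\<close>.\<close>
  have gap: "1 - 4 * e \<le> Ex (?D False S) (T True) - Ex (?D True S) (T True)" if "S \<subseteq> {..<N}" for S
  proof -
    have int: "integrable (?D False S) (T s)" for s
      using T01[of s] by (intro integrable_pmf_bounded[where B = 1]) auto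
    have "1 \<le> Ex (?D False S) (\<lambda>d. T True d + T False d)"
      using int sum1 by (intro measure_pmf.integral_ge_const) auto
    also have "\<dots> = Ex (?D False S) (T True) + Ex (?D False S) (T False)"
      using int by simp
    finally show ?thesis
      using T_le[OF that, of True] T_le[OF that, of False] by simp
  qed
  have set: "set_pmf labels = Pow {..<N}"
    by (intro set_pmf_of_set) auto
  let ?d = "\<lambda>S. Ex (?D True S) (T True) - Ex (?D False S) (T True)"
  have E1: "Ex p (T True) \<in> {0..1}" for p
    by (intro expectation_unit T01)
  have bd: "\<bar>?d S\<bar> \<le> 1" for S
    using E1[of "?D True S"] E1[of "?D False S"] by auto
  have "Ex labels ?d \<le> - (1 - 4 * e)"
  proof (intro measure_pmf.integral_le_const integrable_pmf_bounded[OF bd])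
    show "AE S in labels. ?d S \<le> - (1 - 4 * e)"
      unfolding AE_measure_pmf_iff set
    proof
      fix S assume "S \<in> Pow {..<N}"
      then show "?d S \<le> - (1 - 4 * e)"
        using gap[of S] by simp
    qed
  qed
  \<comment> \<open>The test does not depend on \<open>S\<close>, so the sensitivity starts at
    0.\<close>
  moreover have "\<bar>Ex labels ?d\<bar> \<le> real n * ((1/2) ^ (H - 1) / 4 + 0 + 1 / real N + real n * (2 / real N))"
    by (intro iid_sign_difference T01) auto
  ultimately show ?thesis by simp
qed

end

section \<open>Choice of the parameters\<close>

theorem mainTheorem3:
  shows "\<exists>c>0. \<exists>C>0. \<forall>(\<epsilon>::real) (H::nat). 0 < \<epsilon> \<and> \<epsilon> \<le> 1/15 \<and> 1 \<le> H \<longrightarrow>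
    (\<exists>G::ope_problem set.
       (\<forall>g\<in>G. case g of (M, \<pi>e, \<pi>b, F) \<Rightarrow>
           ope_problem_wf H g \<and> realizable g \<and>
           concentrability M \<pi>e \<pi>b \<le> ereal (C * real H ^ 3) \<and> card F = 2) \<and>
       (\<forall>alg n. (\<forall>g\<in>G. ope_error alg n g \<le> ennreal (\<epsilon> / (16 * real H)))
                  \<longrightarrow> real n \<ge> 2 powr (c * real H)))"
proof (rule exI[of _ 1], intro conjI, simp, rule exI[of _ 4], intro conjI, simp, intro allI impI)
  fix \<epsilon> :: real and H :: nat
  assume A: "0 < \<epsilon> \<and> \<epsilon> \<le> 1/15 \<and> 1 \<le> H"
  \<comment> \<open>With at most \<open>2^H\<close> trajectories, the collision term
    \<open>2 * n^2 / N\<close> is then at most \<open>2 * (1/16)^H\<close>.\<close>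
  define N :: nat where "N = 64 ^ H"
  interpret hidden_label_mdp H N
    using A by unfold_locales (simp_all add: N_def)
  let ?G = "(\<lambda>(s, S). problem s S) ` (UNIV \<times> Pow {..<N})"
  have conc: "concentrability (model s S) target behaviour \<le> ereal (4 * real H ^ 3)" for s S
  proof -
    have "ereal 4 \<le> ereal (4 * real H ^ 3)"
      using A by simp
    with concentrability_model[of s S] show ?thesis
      unfolding numeral_eq_ereal by (rule order_trans)
  qed
  have lower: "2 powr (1 * real H) \<le> real n"
    if err: "\<forall>g\<in>?G. ope_error alg n g \<le> ennreal (\<epsilon> / (16 * real H))" for alg n
  proof (rule ccontr)
    assume "\<not> 2 powr (1 * real H) \<le> real n"
    then have n: "real n \<le> 2 ^ H" by (simp add: powr_realpow)
    define e where "e = \<epsilon> / (16 * real H)"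
    have "\<epsilon> / (16 * real H) \<le> (1/15) / 16"
      using A by (intro frac_le) auto
    then have e: "0 \<le> e" "e \<le> 1/240"
      using A by (simp_all add: e_def)
    have "1 - 4 * e \<le> real n * ((1/2) ^ (H - 1) / 4 + 1 / real N + real n * (2 / real N))"
      using err e(1) by (intro ope_error_lower_bound) (auto simp: e_def)
    also have "\<dots> \<le> 2 ^ H * ((1/2) ^ (H - 1) / 4 + 1 / real N + 2 ^ H * (2 / real N))"
      using n by (intro mult_mono add_mono) auto
    also have "\<dots> = 1 / 2 + 2 ^ H / 64 ^ H + 2 * (4 ^ H / 64 ^ H)"
    proof -
      have "(2::real) ^ H * (1/2) ^ (H - 1) = 2"
        using A by (cases H) (simp_all add: power_mult_distrib[symmetric])
      moreover have "(2::real) ^ H * 2 ^ H = 4 ^ H"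
        by (simp flip: power_mult_distrib)
      ultimately show ?thesis
        by (simp add: N_def algebra_simps)
    qed
    also have "(2::real) ^ H / 64 ^ H = (1/32) ^ H"
      by (simp flip: power_divide)
    also have "(4::real) ^ H / 64 ^ H = (1/16) ^ H"
      by (simp flip: power_divide)
    also have "1 / 2 + (1/32) ^ H + 2 * (1/16) ^ H \<le> 1 / 2 + (1/32) ^ 1 + 2 * (1/16 :: real) ^ 1"
      using A by (intro add_mono mult_left_mono power_decreasing order_refl) auto
    \<comment> \<open>The left side is at least \<open>1 - 1/60\<close>, the right side is
      \<open>1/2 + 1/32 + 1/8 = 21/32\<close>.\<close>
    finally show False
      using e by simp
  qed
  show "\<exists>G::ope_problem set.
       (\<forall>g\<in>G. case g of (M, \<pi>e, \<pi>b, F) \<Rightarrow>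
           ope_problem_wf H g \<and> realizable g \<and>
           concentrability M \<pi>e \<pi>b \<le> ereal (4 * real H ^ 3) \<and> card F = 2) \<and>
       (\<forall>alg n. (\<forall>g\<in>G. ope_error alg n g \<le> ennreal (\<epsilon> / (16 * real H)))
                  \<longrightarrow> real n \<ge> 2 powr (1 * real H))"
  proof (intro exI[of _ ?G] conjI ballI allI impI)
    fix g assume "g \<in> ?G"
    then obtain s S where g: "g = problem s S" by auto
    have "ope_problem_wf H g \<and> realizable g"
      by (simp add: g ope_problem_wf_problem realizable_problem)
    then show "case g of (M, \<pi>e, \<pi>b, F) \<Rightarrow> ope_problem_wf H g \<and> realizable g \<and>
           concentrability M \<pi>e \<pi>b \<le> ereal (4 * real H ^ 3) \<and> card F = 2"
      using conc[of s S] card_range_Qfun by (simp add: g problem_def)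
  qed (rule lower)
qed

end
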